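(* Let $N\ge3$ be an integer and let $2<q\le\frac{2+2N}{N}$. Then there is no non-trivial (i.e. not identically zero) non-negative function $u:\mathbb{Z}^N\to[0,\infty)$ satisfying $$\Delta_2u(x)+u(x)^{q-1}=0\quad\text{for all }x\in\mathbb{Z}^N.$$
   Context: $\mathbb{Z}^N$ is the integer lattice graph: $x\sim y$ iff $\sum_{k=1}^N|x_k-y_k|=1$. For $u:\mathbb{Z}^N\to\mathbb{R}$, $\Delta_2u(x):=\sum_{y\sim x}(u(y)-u(x))$. *)

theory Defs
  imports "HOL-Analysis.Analysis"
begin

definition lattice_adj :: "int ^ 'n \<Rightarrow> int ^ 'n \<Rightarrow> bool" where
  "lattice_adj x y \<longleftrightarrow> (\<Sum>k\<in>UNIV. \<bar>x $ k - y $ k\<bar>) = 1"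

definition lattice_laplacian :: "(int ^ 'n \<Rightarrow> real) \<Rightarrow> int ^ 'n \<Rightarrow> real" where
  "lattice_laplacian u x = (\<Sum>y | lattice_adj x y. u y - u x)"

text \<open>The sum over neighbours is a genuine finite sum, not the default value \<open>0\<close> of an
  infinite one.\<close>

lemma finite_lattice_adj: "finite {y. lattice_adj x (y :: int ^ 'n)}"
proof (rule finite_subset)
  let ?B = "{f. \<forall>k. f k \<in> {x $ k - 1..x $ k + 1}}"
  have "?B = PiE UNIV (\<lambda>k. {x $ k - 1..x $ k + 1})"
    by (auto simp: PiE_def)
  then show "finite (vec_lambda ` ?B)"
    by (simp add: finite_PiE)
  show "{y. lattice_adj x y} \<subseteq> vec_lambda ` ?B"
  proof
    fix y assume "y \<in> {y. lattice_adj x y}"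
    then have s: "(\<Sum>k\<in>UNIV. \<bar>x $ k - y $ k\<bar>) = 1"
      by (simp add: lattice_adj_def)
    have "\<bar>x $ k - y $ k\<bar> \<le> 1" for k
      using member_le_sum[of k UNIV "\<lambda>k. \<bar>x $ k - y $ k\<bar>"] s by simp
    then have "y $ k \<in> {x $ k - 1..x $ k + 1}" for k
      by (smt (verit) atLeastAtMost_iff)
    then show "y \<in> vec_lambda ` ?B"
      by (intro image_eqI[of _ _ "vec_nth y"]) auto
  qed
qed

end

theory Submission
  imports Defs
begin

text \<open>
  Put \<open>p = q - 1\<close>, so that \<open>1 < p \<le> 1 + 2/N\<close>, and suppose \<open>u \<ge> 0\<close> solves
  \<open>-\<Delta>u = u\<^sup>p\<close>. The idea is to test the equation against the first Dirichlet eigenfunction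
  \<open>\<phi>\<close> of the cube of radius \<open>R\<close>, extended by zero. It is a product of cosines, it is
  nonnegative, and \<open>-\<Delta>\<phi> \<le> L \<phi>\<close> holds on the whole lattice with \<open>L = 4N/R\<^sup>2\<close>:
  there is equality (with a smaller constant) in the interior, and outside \<open>\<phi>\<close>
  vanishes while \<open>\<Delta>\<phi> \<ge> 0\<close>. Since \<open>u \<ge> 0\<close>, summation by parts
  (\<open>sum_neg_laplacian_le\<close>) gives
    \<open>\<Sum> u\<^sup>p \<phi> = \<Sum> u (-\<Delta>\<phi>) \<le> L \<Sum> u \<phi>\<close>.

  A Young-type inequality (\<open>linear_le_half_powr\<close>) bounds \<open>L u\<close> by
  \<open>u\<^sup>p/2 + L (2L)\<^sup>s\<close> with \<open>s = 1/(p - 1)\<close>. The first term is absorbed into the left-hand side,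
  and as the cube has at most \<open>(3R)\<^sup>N\<close> points,
    \<open>\<Sum> u\<^sup>p \<phi> \<le> 2 L (2L)\<^sup>s (3R)\<^sup>N\<close>.
  The assumption on \<open>q\<close> says precisely that \<open>s \<ge> N/2\<close>, so \<open>(2L)\<^sup>s\<close> is at most a constant times
  \<open>R\<^sup>-\<^sup>N\<close> and compensates the volume of the cube. The remaining factor \<open>L\<close> decays like
  \<open>R\<^sup>-\<^sup>2\<close>, whereas \<open>\<phi>\<close> stays bounded below at each fixed point.
  Letting \<open>R \<rightarrow> \<infinity>\<close> forces \<open>u = 0\<close>.
\<close>

section \<open>The Laplacian in coordinates\<close>

lemma lattice_adj_iff_axis:
  fixes x y :: "int ^ 'n"
  shows "lattice_adj x y \<longleftrightarrow> (\<exists>k. y = x + axis k 1 \<or> y = x - axis k 1)"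
proof
  assume "lattice_adj x y"
  then have s: "(\<Sum>k\<in>UNIV. \<bar>x $ k - y $ k\<bar>) = 1"
    by (simp add: lattice_adj_def)
  then obtain k where k: "x $ k \<noteq> y $ k"
    by fastforce
  have "(\<Sum>j\<in>UNIV. \<bar>x $ j - y $ j\<bar>) = \<bar>x $ k - y $ k\<bar> + (\<Sum>j\<in>UNIV - {k}. \<bar>x $ j - y $ j\<bar>)"
    by (rule sum.remove) auto
  moreover have "(\<Sum>j\<in>UNIV - {k}. \<bar>x $ j - y $ j\<bar>) \<ge> 0"
    by (rule sum_nonneg) auto
  ultimately have one: "\<bar>x $ k - y $ k\<bar> = 1" and rest: "(\<Sum>j\<in>UNIV - {k}. \<bar>x $ j - y $ j\<bar>) = 0"
    using s k by linarith+
  have "x $ j = y $ j" if "j \<noteq> k" for j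
    using rest that by (subst (asm) sum_nonneg_eq_0_iff) auto
  then have "y = x + axis k 1 \<or> y = x - axis k 1"
    using one by (auto simp: vec_eq_iff axis_def abs_if split: if_splits)
  then show "\<exists>k. y = x + axis k 1 \<or> y = x - axis k 1" ..
next
  have "(\<Sum>j\<in>UNIV. \<bar>axis k (1::int) $ j\<bar>) = 1" for k :: 'n
    by (simp add: axis_def if_distrib cong: if_cong)
  moreover assume "\<exists>k. y = x + axis k 1 \<or> y = x - axis k 1"
  ultimately show "lattice_adj x y"
    by (auto simp: lattice_adj_def)
qed

lemma lattice_laplacian_eq_second_differences:
  fixes u :: "int ^ 'n \<Rightarrow> real"
  shows "lattice_laplacian u x = (\<Sum>k\<in>UNIV. u (x + axis k 1) + u (x - axis k 1) - 2 * u x)"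
proof -
  let ?A = "range (\<lambda>k. x + axis k 1)" and ?B = "range (\<lambda>k. x - axis k 1)"
  have nbrs: "{y. lattice_adj x y} = ?A \<union> ?B"
    by (auto simp: lattice_adj_iff_axis)
  have "axis k (1::int) \<noteq> - axis j 1" for k j :: 'n
  proof
    assume "axis k (1::int) = - axis j 1"
    then have "axis k (1::int) $ k = (- axis j 1) $ k"
      by simp
    then show False
      by (simp add: axis_def split: if_splits)
  qed
  then have disj: "?A \<inter> ?B = {}"
    by (auto simp: diff_conv_add_uminus simp del: add_uminus_conv_diff)
  have inj: "inj (\<lambda>k. x + axis k 1)" "inj (\<lambda>k. x - axis k 1)"
    by (auto simp: inj_on_def axis_eq_axis)
  have "lattice_laplacian u x = (\<Sum>y\<in>?A. u y - u x) + (\<Sum>y\<in>?B. u y - u x)"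
    unfolding lattice_laplacian_def nbrs by (rule sum.union_disjoint) (use disj in auto)
  also have "\<dots> = (\<Sum>k\<in>UNIV. u (x + axis k 1) - u x) + (\<Sum>k\<in>UNIV. u (x - axis k 1) - u x)"
    using inj by (simp add: sum.reindex)
  finally show ?thesis
    by (simp add: sum.distrib [symmetric] algebra_simps)
qed

section \<open>The Dirichlet eigenfunction of a cube\<close>

definition cosine_bump :: "nat \<Rightarrow> int \<Rightarrow> real" where
  "cosine_bump R k = (if \<bar>k\<bar> < int R then cos (pi * real_of_int k / (2 * real R)) else 0)"

definition cube_bump :: "nat \<Rightarrow> int ^ 'n \<Rightarrow> real" where
  "cube_bump R x = (\<Prod>k\<in>UNIV. cosine_bump R (x $ k))"

definition cube :: "nat \<Rightarrow> (int ^ 'n) set" where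
  "cube R = {x. \<forall>k. \<bar>x $ k\<bar> \<le> int R}"

lemma cosine_bump_nonneg: "cosine_bump R k \<ge> 0"
proof (cases "\<bar>k\<bar> < int R")
  case True
  then have "\<bar>real_of_int k\<bar> \<le> real R" "real R > 0"
    by linarith+
  then have "\<bar>pi * real_of_int k / (2 * real R)\<bar> \<le> pi / 2"
    by (simp add: abs_mult field_simps)
  then have "- (pi / 2) \<le> pi * real_of_int k / (2 * real R)"
    and "pi * real_of_int k / (2 * real R) \<le> pi / 2"
    by linarith+
  then show ?thesis
    using True by (simp add: cosine_bump_def cos_ge_zero)
qed (simp add: cosine_bump_def)

lemma cosine_bump_le_1: "cosine_bump R k \<le> 1"
  by (simp add: cosine_bump_def)

text \<open>The cosine already vanishes at the end points \<open>\<plusminus>R\<close>, so cutting it off changes no value at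
  a neighbour of an interior point.\<close>

lemma cosine_bump_eq_cos:
  assumes "\<bar>k\<bar> \<le> int R" "R > 0"
  shows "cosine_bump R k = cos (pi * real_of_int k / (2 * real R))"
proof (cases "\<bar>k\<bar> < int R")
  case False
  then have "k = int R \<or> k = - int R"
    using assms by linarith
  then have "pi * real_of_int k / (2 * real R) = pi / 2
      \<or> pi * real_of_int k / (2 * real R) = - (pi / 2)"
    using assms by auto
  then have "cos (pi * real_of_int k / (2 * real R)) = 0"
    by (metis cos_minus cos_pi_half)
  then show ?thesis
    using False by (simp add: cosine_bump_def)
qed (simp add: cosine_bump_def)

text \<open>In the interior the addition theorem
  \<open>cos (t + a) + cos (t - a) = 2 cos a cos t\<close> makes the cosine an eigenfunction with eigenvalue
  \<open>2 (1 - cos a) \<le> a\<^sup>2\<close>, where \<open>a = \<pi>/(2R)\<close>; the constant is rounded up by \<open>\<pi>\<^sup>2 \<le> 16\<close>.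
  Outside, the left-hand side is at most zero.\<close>

lemma cosine_bump_second_difference:
  assumes "R > 0"
  shows "2 * cosine_bump R k - cosine_bump R (k + 1) - cosine_bump R (k - 1)
    \<le> 4 / (real R)\<^sup>2 * cosine_bump R k"
proof (cases "\<bar>k\<bar> < int R")
  case False
  then have "cosine_bump R k = 0"
    by (simp add: cosine_bump_def)
  then show ?thesis
    using cosine_bump_nonneg[of R "k + 1"] cosine_bump_nonneg[of R "k - 1"] by simp
next
  case True
  define a where "a = pi / (2 * real R)"
  have eq: "cosine_bump R j = cos (a * real_of_int j)" if "\<bar>j\<bar> \<le> int R" for j
    using cosine_bump_eq_cos[OF that assms] by (simp add: a_def)
  have "cosine_bump R (k + 1) + cosine_bump R (k - 1) = 2 * cos a * cosine_bump R k"
    using True by (simp add: eq cos_add cos_diff distrib_left right_diff_distrib)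
  then have "2 * cosine_bump R k - cosine_bump R (k + 1) - cosine_bump R (k - 1)
      = 2 * (1 - cos a) * cosine_bump R k"
    by (simp add: algebra_simps)
  also have "\<dots> \<le> 4 / (real R)\<^sup>2 * cosine_bump R k"
  proof (rule mult_right_mono[OF _ cosine_bump_nonneg])
    have sin_sq: "(sin (a / 2))\<^sup>2 \<le> (a / 2)\<^sup>2"
      using abs_sin_x_le_abs_x[of "a / 2"] by (simp only: abs_le_square_iff)
    have "1 - cos a = 2 * (sin (a / 2))\<^sup>2"
      using cos_double_sin[of "a / 2"] by simp
    also have "\<dots> \<le> 2 * (a / 2)\<^sup>2"
      by (rule mult_left_mono[OF sin_sq]) simp
    finally have "2 * (1 - cos a) \<le> a\<^sup>2"
      by (simp add: power2_eq_square)
    also have "\<dots> \<le> (2 / real R)\<^sup>2"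
      unfolding a_def using assms pi_less_4 by (intro power_mono) (auto simp: field_simps)
    finally show "2 * (1 - cos a) \<le> 4 / (real R)\<^sup>2"
      by (simp add: power_divide)
  qed
  finally show ?thesis .
qed

lemma cosine_bump_ge_half:
  assumes "3 * \<bar>k\<bar> \<le> 2 * int R" "R > 0"
  shows "cosine_bump R k \<ge> 1 / 2"
proof -
  define t where "t = pi * \<bar>real_of_int k\<bar> / (2 * real R)"
  have "3 * \<bar>real_of_int k\<bar> \<le> 2 * real R"
    using assms by linarith
  then have "t \<le> pi / 3" "t \<ge> 0"
    using assms by (simp_all add: t_def field_simps)
  then have "cos (pi / 3) \<le> cos t"
    by (intro cos_monotone_0_pi_le) auto
  moreover have "cos t = cos (pi * real_of_int k / (2 * real R))"
    using cos_abs_real[of "pi * real_of_int k / (2 * real R)"]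
    by (simp add: t_def abs_mult)
  ultimately show ?thesis
    using cosine_bump_eq_cos[of k R] assms by (simp add: cos_60)
qed

lemma cube_bump_nonneg: "cube_bump R x \<ge> 0"
  by (simp add: cube_bump_def prod_nonneg cosine_bump_nonneg)

lemma cube_bump_le_1: "cube_bump R x \<le> 1"
  by (simp add: cube_bump_def prod_le_1 cosine_bump_nonneg cosine_bump_le_1)

lemma cube_bump_nonzeroD:
  assumes "cube_bump R x \<noteq> 0"
  shows "\<bar>x $ k\<bar> < int R"
  using assms by (auto simp: cube_bump_def cosine_bump_def split: if_splits)

lemma cube_bump_ge:
  fixes x :: "int ^ 'n"
  assumes "\<And>k. 3 * \<bar>x $ k\<bar> \<le> 2 * int R" "R > 0"
  shows "cube_bump R x \<ge> (1 / 2) ^ CARD('n)"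
proof -
  have "(\<Prod>k\<in>(UNIV :: 'n set). 1 / 2 :: real) \<le> cube_bump R x"
    unfolding cube_bump_def by (rule prod_mono) (use assms cosine_bump_ge_half in auto)
  then show ?thesis
    by simp
qed

lemma cube_bump_second_difference:
  fixes x :: "int ^ 'n"
  assumes "R > 0"
  shows "2 * cube_bump R x - cube_bump R (x + axis k 1) - cube_bump R (x - axis k 1)
    \<le> 4 / (real R)\<^sup>2 * cube_bump R x"
proof -
  define P where "P = (\<Prod>j\<in>UNIV - {k}. cosine_bump R (x $ j))"
  have split: "cube_bump R (x + axis k c) = cosine_bump R (x $ k + c) * P" for c
  proof -
    have "cube_bump R (x + axis k c) = cosine_bump R ((x + axis k c) $ k)
        * (\<Prod>j\<in>UNIV - {k}. cosine_bump R ((x + axis k c) $ j))"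
      unfolding cube_bump_def by (rule prod.remove) auto
    also have "(\<Prod>j\<in>UNIV - {k}. cosine_bump R ((x + axis k c) $ j)) = P"
      unfolding P_def by (rule prod.cong) (auto simp: axis_def)
    finally show ?thesis
      by (simp add: axis_def)
  qed
  have "P \<ge> 0"
    by (simp add: P_def prod_nonneg cosine_bump_nonneg)
  have neg: "x - axis k 1 = x + axis k (- 1)" and zero: "x = x + axis k 0"
    by (auto simp: vec_eq_iff axis_def)
  have val: "cube_bump R x = cosine_bump R (x $ k) * P"
    using split[of 0] zero by simp
  have "(2 * cosine_bump R (x $ k) - cosine_bump R (x $ k + 1) - cosine_bump R (x $ k - 1)) * P
      \<le> (4 / (real R)\<^sup>2 * cosine_bump R (x $ k)) * P"
    using cosine_bump_second_difference[OF assms] \<open>P \<ge> 0\<close> by (rule mult_right_mono)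
  then show ?thesis
    unfolding neg split val by (simp add: algebra_simps)
qed

lemma finite_cube: "finite (cube R :: (int ^ 'n) set)"
  and card_cube_le: "card (cube R :: (int ^ 'n) set) \<le> (2 * R + 1) ^ CARD('n)"
proof -
  let ?F = "PiE UNIV (\<lambda>k :: 'n. {- int R..int R})"
  have sub: "(cube R :: (int ^ 'n) set) \<subseteq> vec_lambda ` ?F"
  proof
    fix x :: "int ^ 'n" assume "x \<in> cube R"
    then have "vec_nth x \<in> ?F"
      by (auto simp: cube_def abs_le_iff minus_le_iff)
    then show "x \<in> vec_lambda ` ?F"
      by (intro image_eqI[of _ _ "vec_nth x"]) auto
  qed
  have fin: "finite ?F"
    by (simp add: finite_PiE)
  show "finite (cube R :: (int ^ 'n) set)"
    using sub fin by (meson finite_imageI finite_subset)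
  have "card (cube R :: (int ^ 'n) set) \<le> card ?F"
    using sub fin by (meson card_image_le card_mono finite_imageI le_trans)
  also have "card ?F = (2 * R + 1) ^ CARD('n)"
    by (simp add: card_PiE nat_add_distrib nat_mult_distrib)
  finally show "card (cube R :: (int ^ 'n) set) \<le> (2 * R + 1) ^ CARD('n)" .
qed

section \<open>Testing a nonnegative function against the eigenfunction\<close>

text \<open>Translating the summation variable by a unit vector loses nothing, because the support of
  the bump is the open cube, whose neighbours still lie in the closed cube.\<close>

lemma sum_cube_bump_shift:
  fixes e :: "int ^ 'n" and u :: "int ^ 'n \<Rightarrow> real"
  assumes "\<And>k. \<bar>e $ k\<bar> \<le> 1"
  shows "(\<Sum>x\<in>cube R. cube_bump R x * u (x + e)) = (\<Sum>x\<in>cube R. cube_bump R (x - e) * u x)"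
proof (rule sum.reindex_bij_witness_not_neutral
    [where i = "\<lambda>y. y - e" and j = "\<lambda>x. x + e"
      and S' = "{x \<in> cube R. cube_bump R x = 0}" and T' = "{y \<in> cube R. cube_bump R (y - e) = 0}"])
  fix x :: "int ^ 'n" assume "x \<in> cube R - {x \<in> cube R. cube_bump R x = 0}"
  then have nz: "cube_bump R x \<noteq> 0"
    by auto
  have "\<bar>(x + e) $ k\<bar> \<le> int R" for k
    using cube_bump_nonzeroD[OF nz, of k] assms[of k] by simp
  then show "x + e \<in> cube R - {y \<in> cube R. cube_bump R (y - e) = 0}"
    using nz by (auto simp: cube_def)
next
  fix y :: "int ^ 'n" assume "y \<in> cube R - {y \<in> cube R. cube_bump R (y - e) = 0}"
  then have nz: "cube_bump R (y - e) \<noteq> 0"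
    by auto
  then show "y - e \<in> cube R - {x \<in> cube R. cube_bump R x = 0}"
    using cube_bump_nonzeroD[OF nz] by (auto simp: cube_def less_imp_le)
qed (auto simp: finite_cube)

lemma sum_neg_laplacian_le:
  fixes u :: "int ^ 'n \<Rightarrow> real"
  assumes u: "\<And>x. u x \<ge> 0" and "R > 0"
  shows "(\<Sum>x\<in>cube R. cube_bump R x * - lattice_laplacian u x)
    \<le> 4 * real CARD('n) / (real R)\<^sup>2 * (\<Sum>x\<in>cube R. cube_bump R x * u x)"
proof -
  let ?\<phi> = "cube_bump R :: int ^ 'n \<Rightarrow> real" and ?S = "\<Sum>x\<in>cube R. cube_bump R x * u x"
  have axis_k: "(\<Sum>x\<in>cube R. ?\<phi> x * (2 * u x - u (x + axis k 1) - u (x - axis k 1)))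
      \<le> 4 / (real R)\<^sup>2 * ?S" for k
  proof -
    have bd: "\<bar>axis k (1::int) $ j\<bar> \<le> 1" "\<bar>(- axis k (1::int)) $ j\<bar> \<le> 1" for j
      by (auto simp: axis_def)
    have "(\<Sum>x\<in>cube R. ?\<phi> x * (2 * u x - u (x + axis k 1) - u (x - axis k 1)))
        = 2 * ?S - (\<Sum>x\<in>cube R. ?\<phi> x * u (x + axis k 1))
          - (\<Sum>x\<in>cube R. ?\<phi> x * u (x + - axis k 1))"
      by (simp add: sum_subtractf sum.distrib sum_distrib_left algebra_simps)
    also have "\<dots> = 2 * ?S - (\<Sum>x\<in>cube R. ?\<phi> (x - axis k 1) * u x)
          - (\<Sum>x\<in>cube R. ?\<phi> (x - - axis k 1) * u x)"
      unfolding sum_cube_bump_shift[OF bd(1)] sum_cube_bump_shift[OF bd(2)] ..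
    also have "\<dots> = (\<Sum>x\<in>cube R. (2 * ?\<phi> x - ?\<phi> (x + axis k 1) - ?\<phi> (x - axis k 1)) * u x)"
      by (simp add: sum_subtractf sum.distrib sum_distrib_left algebra_simps)
    also have "\<dots> \<le> (\<Sum>x\<in>cube R. 4 / (real R)\<^sup>2 * ?\<phi> x * u x)"
      by (intro sum_mono mult_right_mono cube_bump_second_difference assms)
    also have "\<dots> = 4 / (real R)\<^sup>2 * ?S"
      by (simp only: sum_distrib_left mult.assoc)
    finally show ?thesis .
  qed
  have "(\<Sum>x\<in>cube R. ?\<phi> x * - lattice_laplacian u x)
      = (\<Sum>x\<in>cube R. \<Sum>k\<in>UNIV. ?\<phi> x * (2 * u x - u (x + axis k 1) - u (x - axis k 1)))"
    unfolding lattice_laplacian_eq_second_differences sum_negf [symmetric] sum_distrib_left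
    by (intro sum.cong refl) (simp add: algebra_simps)
  also have "\<dots> = (\<Sum>k\<in>UNIV. \<Sum>x\<in>cube R. ?\<phi> x * (2 * u x - u (x + axis k 1) - u (x - axis k 1)))"
    by (rule sum.swap)
  also have "\<dots> \<le> (\<Sum>k\<in>(UNIV :: 'n set). 4 / (real R)\<^sup>2 * ?S)"
    by (intro sum_mono axis_k)
  finally show ?thesis
    by (simp add: ac_simps)
qed

section \<open>The integral estimate\<close>

text \<open>Either \<open>t\<close> is so large that the power dominates, or \<open>t\<close> lies below the threshold
  \<open>(2L)\<^sup>1\<^sup>/\<^sup>(\<^sup>p\<^sup>-\<^sup>1\<^sup>)\<close> at which \<open>t\<^sup>p\<^sup>-\<^sup>1 = 2L\<close>.\<close>

lemma linear_le_half_powr: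
  fixes t L p :: real
  assumes "t \<ge> 0" "L \<ge> 0" "p > 1"
  shows "L * t \<le> t powr p / 2 + L * (2 * L) powr (1 / (p - 1))"
proof (cases "2 * L \<le> t powr (p - 1)")
  case True
  have "t * (2 * L) \<le> t * t powr (p - 1)"
    using True assms by (intro mult_left_mono)
  also have "\<dots> = t powr p"
    using assms by (cases "t = 0") (simp_all add: powr_mult_base)
  finally have "L * t \<le> t powr p / 2"
    by (simp add: algebra_simps)
  moreover have "L * (2 * L) powr (1 / (p - 1)) \<ge> 0"
    using assms by simp
  ultimately show ?thesis
    by linarith
next
  case False
  have "t = (t powr (p - 1)) powr (1 / (p - 1))"
    using assms by (simp add: powr_powr)
  also have "\<dots> \<le> (2 * L) powr (1 / (p - 1))"
    using False assms by (intro powr_mono2) auto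
  finally have "L * t \<le> L * (2 * L) powr (1 / (p - 1))"
    using assms by (intro mult_left_mono)
  moreover have "t powr p / 2 \<ge> 0"
    by simp
  ultimately show ?thesis
    by linarith
qed

text \<open>The half of \<open>\<Sum> u\<^sup>p \<phi>\<close> that the Young-type inequality produces is absorbed into the
  left-hand side; this is legitimate because all the sums are finite. What remains is a constant
  times the number of points of the cube.\<close>

lemma sum_powr_cube_bump_le:
  fixes u :: "int ^ 'n \<Rightarrow> real"
  assumes u: "\<And>x. u x \<ge> 0" and super: "\<And>x. u x powr p \<le> - lattice_laplacian u x"
    and "p > 1" "R > 0"
  defines "L \<equiv> 4 * real CARD('n) / (real R)\<^sup>2"
  shows "(\<Sum>x\<in>cube R. cube_bump R x * u x powr p)
    \<le> 2 * L * (2 * L) powr (1 / (p - 1)) * (2 * real R + 1) ^ CARD('n)"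
proof -
  let ?\<phi> = "cube_bump R :: int ^ 'n \<Rightarrow> real"
  define T where "T = (\<Sum>x\<in>cube R. ?\<phi> x * u x powr p)"
  define c where "c = L * (2 * L) powr (1 / (p - 1))"
  have "L \<ge> 0"
    by (simp add: L_def)
  then have "c \<ge> 0"
    by (simp add: c_def)
  have "T \<le> (\<Sum>x\<in>cube R. ?\<phi> x * - lattice_laplacian u x)"
    unfolding T_def by (intro sum_mono mult_left_mono super cube_bump_nonneg)
  also have "\<dots> \<le> L * (\<Sum>x\<in>cube R. ?\<phi> x * u x)"
    unfolding L_def by (rule sum_neg_laplacian_le[OF u \<open>R > 0\<close>])
  also have "\<dots> = (\<Sum>x\<in>cube R. ?\<phi> x * (L * u x))"
    by (simp add: sum_distrib_left algebra_simps)
  also have "\<dots> \<le> (\<Sum>x\<in>cube R. ?\<phi> x * (u x powr p / 2 + c))"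
    unfolding c_def
    by (intro sum_mono mult_left_mono linear_le_half_powr cube_bump_nonneg u \<open>L \<ge> 0\<close> \<open>p > 1\<close>)
  also have "\<dots> = T / 2 + (\<Sum>x\<in>cube R. ?\<phi> x * c)"
    by (simp add: T_def sum.distrib sum_divide_distrib distrib_left)
  also have "(\<Sum>x\<in>cube R. ?\<phi> x * c) \<le> (\<Sum>x\<in>(cube R :: (int ^ 'n) set). 1 * c)"
    by (intro sum_mono mult_right_mono cube_bump_le_1 \<open>c \<ge> 0\<close>)
  also have "\<dots> = real (card (cube R :: (int ^ 'n) set)) * c"
    by simp
  also have "\<dots> \<le> real ((2 * R + 1) ^ CARD('n)) * c"
    using card_cube_le[where 'n = 'n, of R] \<open>c \<ge> 0\<close> by (intro mult_right_mono) (simp_all only: of_nat_le_iff)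
  finally have "T \<le> 2 * (real ((2 * R + 1) ^ CARD('n)) * c)"
    by simp
  then show ?thesis
    by (simp add: T_def c_def algebra_simps)
qed

text \<open>In the subcritical range the threshold \<open>(2L)\<^sup>1\<^sup>/\<^sup>(\<^sup>p\<^sup>-\<^sup>1\<^sup>)\<close> is at most of order
  \<open>R\<^sup>-\<^sup>N\<close> and cancels the volume. The side condition on \<open>R\<close> says \<open>2L \<le> 1\<close>, which makes
  powers of \<open>2L\<close> decreasing in the exponent.\<close>

lemma sum_powr_cube_bump_le_inverse_square:
  fixes u :: "int ^ 'n \<Rightarrow> real"
  assumes u: "\<And>x. u x \<ge> 0" and super: "\<And>x. u x powr p \<le> - lattice_laplacian u x"
    and p: "p > 1" "p \<le> 1 + 2 / real CARD('n)"
    and R: "R > 0" "8 * real CARD('n) \<le> (real R)\<^sup>2"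
  shows "(\<Sum>x\<in>cube R. cube_bump R x * u x powr p)
    \<le> 8 * real CARD('n) * (3 * sqrt (8 * real CARD('n))) ^ CARD('n) / (real R)\<^sup>2"
proof -
  let ?N = "CARD('n)"
  define L where "L = 4 * real ?N / (real R)\<^sup>2"
  define s where "s = 1 / (p - 1)"
  have N: "real ?N > 0" and Rpos: "real R > 0"
    using R by simp_all
  have L: "2 * L > 0" "2 * L \<le> 1"
    using N R by (simp_all add: L_def)
  have "real ?N / 2 \<le> s"
    using p N by (simp add: s_def field_simps)
  then have "(2 * L) powr s \<le> (2 * L) powr (real ?N / 2)"
    using L by (intro powr_mono') auto
  also have "\<dots> = ((2 * L) powr (1 / 2)) ^ ?N"
    using L by (simp add: powr_powr powr_realpow [symmetric])
  also have "(2 * L) powr (1 / 2) = sqrt (8 * real ?N) / real R"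
    using L by (simp add: powr_half_sqrt L_def real_sqrt_divide)
  finally have pow: "(2 * L) powr s \<le> (sqrt (8 * real ?N) / real R) ^ ?N" .
  have vol: "(2 * real R + 1) ^ ?N \<le> (3 * real R) ^ ?N"
    using R by (intro power_mono) auto
  have "(\<Sum>x\<in>cube R. cube_bump R x * u x powr p) \<le> 2 * L * (2 * L) powr s * (2 * real R + 1) ^ ?N"
    unfolding L_def s_def by (rule sum_powr_cube_bump_le[OF u super p(1) R(1)])
  also have "\<dots> \<le> 2 * L * (sqrt (8 * real ?N) / real R) ^ ?N * (3 * real R) ^ ?N"
    using pow vol L by (intro mult_mono mult_left_mono) auto
  also have "\<dots> = 2 * L * (3 * sqrt (8 * real ?N)) ^ ?N"
    using Rpos by (simp add: power_divide power_mult_distrib)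
  finally show ?thesis
    by (simp add: L_def)
qed

section \<open>The Liouville theorem\<close>

theorem theorem5:
  fixes q :: real
  assumes "CARD('n::finite) \<ge> 3"
    and "2 < q"
    and "q \<le> (2 + 2 * real CARD('n)) / real CARD('n)"
  shows "\<not> (\<exists>u :: int ^ 'n \<Rightarrow> real.
    (\<forall>x. u x \<ge> 0) \<and> (\<exists>x. u x \<noteq> 0) \<and>
    (\<forall>x. lattice_laplacian u x + u x powr (q - 1) = 0))"
proof
  let ?N = "real CARD('n)"
  assume "\<exists>u :: int ^ 'n \<Rightarrow> real. (\<forall>x. u x \<ge> 0) \<and> (\<exists>x. u x \<noteq> 0) \<and>
    (\<forall>x. lattice_laplacian u x + u x powr (q - 1) = 0)"
  then obtain u :: "int ^ 'n \<Rightarrow> real" and z where u: "\<And>x. u x \<ge> 0" and z: "u z \<noteq> 0"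
    and eq: "\<And>x. lattice_laplacian u x + u x powr (q - 1) = 0"
    by blast
  have super: "u x powr (q - 1) \<le> - lattice_laplacian u x" for x
    using eq[of x] by linarith
  have p: "q - 1 > 1" "q - 1 \<le> 1 + 2 / ?N"
    using assms by (simp_all add: field_simps)
  define m where "m = (1 / 2) ^ CARD('n) * u z powr (q - 1)"
  define C where "C = 8 * ?N * (3 * sqrt (8 * ?N)) ^ CARD('n)"
  have "m > 0"
    using z by (simp add: m_def)
  have "C \<ge> 0"
    by (simp add: C_def)
  define M where "M = (\<Sum>k\<in>UNIV. \<bar>z $ k\<bar>)"
  have zM: "\<bar>z $ k\<bar> \<le> M" for k
    unfolding M_def by (rule member_le_sum) auto
  \<comment> \<open>The summands give, in turn, \<open>R > 0\<close>, \<open>8N \<le> R\<^sup>2\<close>, that \<open>z\<close> lies deep inside the cube, and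
    \<open>C/R\<^sup>2 < m\<close>.\<close>
  obtain R :: nat where R_large: "real R \<ge> 1 + 8 * ?N + 2 * real_of_int M + C / m"
    using real_arch_simple by blast
  have "M \<ge> 0"
    by (simp add: M_def sum_nonneg)
  moreover have "C / m \<ge> 0"
    using \<open>m > 0\<close> \<open>C \<ge> 0\<close> by simp
  ultimately have R: "real R \<ge> 1" "real R \<ge> 8 * ?N" "real R \<ge> 2 * real_of_int M" "real R > C / m"
    using R_large by (simp_all add: add_increasing add_increasing2)
  have Rsq: "real R \<le> (real R)\<^sup>2"
    using R by (simp add: self_le_power)
  have zR: "3 * \<bar>z $ k\<bar> \<le> 2 * int R" for k
    using zM[of k] R(3) by linarith
  have "\<bar>z $ k\<bar> \<le> int R" for k
    using zR[of k] by linarith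
  then have "z \<in> cube R"
    by (simp add: cube_def)
  have "m \<le> cube_bump R z * u z powr (q - 1)"
    unfolding m_def using R zR by (intro mult_right_mono cube_bump_ge) auto
  also have "\<dots> \<le> (\<Sum>x\<in>cube R. cube_bump R x * u x powr (q - 1))"
    using \<open>z \<in> cube R\<close>
    by (intro member_le_sum) (auto simp: finite_cube cube_bump_nonneg)
  also have "\<dots> \<le> C / (real R)\<^sup>2"
    unfolding C_def
  proof (rule sum_powr_cube_bump_le_inverse_square[OF u super p])
    show "R > 0"
      using R by simp
    show "8 * ?N \<le> (real R)\<^sup>2"
      using R Rsq by linarith
  qed
  also have "\<dots> \<le> C / real R"
    using R Rsq \<open>C \<ge> 0\<close> by (intro divide_left_mono) auto
  also have "\<dots> < m"
    using R \<open>m > 0\<close> by (simp add: field_simps)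
  finally show False
    by simp
qed

end
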